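(* For every integer $q\ge 1$, let $H_q=\{x\in\{-1,+1\}^q : \prod_{i\in[q]} x_i=+1\}$ be the even-weight half-fraction, regarded as a two-level design on $q$ factors in which each element of $H_q$ occurs with multiplicity one. Then $H_q$ has $2^{\,q-1}$ runs, $j([q])=2^{\,q-1}$, and $j(s)=0$ for every $s\subseteq[q]$ with $\varnothing\ne s\ne[q]$.
   Context: $[q]=\{1,2,\dots,q\}$. A two-level design on $q$ factors is a finite multiset of elements (runs) of $\{-1,+1\}^q$. Its $J$-characteristics are the integers $j(s)=\sum_{\text{runs } r}\prod_{i\in s} r_i$ for $s\subseteq[q]$ (runs counted with multiplicity); thus for $H_q$, $j(s)=\sum_{x\in H_q}\prod_{i\in s}x_i$. *)

theory Defs
  imports Main "HOL-Library.Multiset" "HOL-Library.FuncSet"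
begin

text \<open>The points of $\{-1,+1\}^q$ are the extensional functions on \<open>{1..q}\<close>, so that distinct
  functions are distinct points.\<close>

definition sign_vectors :: "nat \<Rightarrow> (nat \<Rightarrow> int) set" where
  "sign_vectors q = {1..q} \<rightarrow>\<^sub>E {-1, 1}"

definition two_level_design :: "nat \<Rightarrow> (nat \<Rightarrow> int) multiset \<Rightarrow> bool" where
  "two_level_design q D \<longleftrightarrow> set_mset D \<subseteq> sign_vectors q"

definition J_char :: "(nat \<Rightarrow> int) multiset \<Rightarrow> nat set \<Rightarrow> int" where
  "J_char D s = (\<Sum>r\<in>#D. \<Prod>i\<in>s. r i)"

definition even_half_set :: "nat \<Rightarrow> (nat \<Rightarrow> int) set" where
  "even_half_set q = {x \<in> sign_vectors q. (\<Prod>i\<in>{1..q}. x i) = 1}"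

definition even_half_fraction :: "nat \<Rightarrow> (nat \<Rightarrow> int) multiset" where
  "even_half_fraction q = mset_set (even_half_set q)"

text \<open>\<open>mset_set\<close> is the empty multiset on infinite sets; the following facts show that here
  it yields a design in which each element has multiplicity one.\<close>

lemma finite_even_half_set: "finite (even_half_set q)"
  unfolding even_half_set_def sign_vectors_def by (simp add: finite_PiE)

lemma two_level_design_even_half_fraction: "two_level_design q (even_half_fraction q)"
  using finite_even_half_set[of q]
  by (auto simp: two_level_design_def even_half_fraction_def even_half_set_def)

lemma count_even_half_fraction:
  "count (even_half_fraction q) x = (if x \<in> even_half_set q then 1 else 0)"
  using finite_even_half_set[of q] by (simp add: even_half_fraction_def)

end

theory Submission
  imports Defs
begin

text \<open>The indicator of the half-fraction on all sign vectors is \<open>(1 + \<Prod>i\<in>{1..q}. x i) / 2\<close>, and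
  multiplying \<open>\<Prod>i\<in>s. x i\<close> by the full product gives the product over the complement of \<open>s\<close>.
  Hence twice the characteristic of the half-fraction at \<open>s\<close> is the sum of the characteristics of
  the full factorial design at \<open>s\<close> and at its complement, and the latter vanish except at the
  empty set.\<close>

text \<open>The sum over a product space factors over the coordinates: each coordinate in
  \<open>s\<close> contributes -1 + 1 = 0, each other one 1 + 1 = 2.\<close>

lemma sum_sign_vectors_prod:
  assumes "s \<subseteq> {1..q}"
  shows "(\<Sum>x\<in>sign_vectors q. \<Prod>i\<in>s. x i) = (if s = {} then 2 ^ q else 0)"
proof -
  \<comment> \<open>Padding with factors 1 lets the product range over all coordinates, as
    \<open>prod_sum_PiE\<close> requires.\<close>
  have restrict: "(\<Prod>i\<in>s. x i) = (\<Prod>i\<in>{1..q}. if i \<in> s then x i else 1)" for x :: "nat \<Rightarrow> int"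
    using assms by (simp add: prod.If_cases Int_absorb1)
  have "(\<Sum>x\<in>sign_vectors q. \<Prod>i\<in>s. x i)
      = (\<Prod>i\<in>{1..q}. \<Sum>v\<in>{-1, 1 :: int}. if i \<in> s then v else 1)"
    unfolding restrict sign_vectors_def by (subst prod_sum_PiE) auto
  also have "\<dots> = (\<Prod>i\<in>{1..q}. if i \<in> s then 0 else 2)"
    by (intro prod.cong) auto
  also have "\<dots> = (if s = {} then 2 ^ q else 0)"
    using assms by (auto simp: prod_zero_iff)
  finally show ?thesis .
qed

lemma prod_sign_vector:
  assumes "x \<in> sign_vectors q" and "s \<subseteq> {1..q}"
  shows "(\<Prod>i\<in>s. x i) = 1 \<or> (\<Prod>i\<in>s. x i) = -1"
proof -
  have "x i = 1 \<or> x i = -1" if "i \<in> s" for i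
    using assms that by (fastforce simp: sign_vectors_def PiE_iff)
  then show ?thesis
    by (induction s rule: infinite_finite_induct) force+
qed

lemma J_char_even_half_fraction:
  "J_char (even_half_fraction q) s = (\<Sum>x\<in>even_half_set q. \<Prod>i\<in>s. x i)"
  by (simp add: J_char_def even_half_fraction_def sum_unfold_sum_mset)

text \<open>Doubling absorbs the 1/2 of the indicator and keeps the identity in the integers. The
  summands belong to \<open>s\<close> and its complement; both are nonzero when
  \<open>q = 0\<close>.\<close>

lemma two_J_char_even_half_fraction:
  assumes s: "s \<subseteq> {1..q}"
  shows "2 * J_char (even_half_fraction q) s
    = (if s = {} then 2 ^ q else 0) + (if s = {1..q} then 2 ^ q else 0)"
proof -
  let ?p = "\<lambda>x s. \<Prod>i\<in>s. x i :: int"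
  have "finite (sign_vectors q)"
    by (simp add: sign_vectors_def finite_PiE)
  then have "2 * J_char (even_half_fraction q) s
      = (\<Sum>x\<in>sign_vectors q. if ?p x {1..q} = 1 then 2 * ?p x s else 0)"
    by (simp add: J_char_even_half_fraction even_half_set_def sum_distrib_left sum.inter_filter
        if_distrib[of "(*) 2"] cong: if_cong)
  also have "\<dots> = (\<Sum>x\<in>sign_vectors q. ?p x s + ?p x ({1..q} - s))"
  proof (intro sum.cong refl)
    fix x assume x: "x \<in> sign_vectors q"
    \<comment> \<open>Both factors are 1 or -1: if their product is 1 they agree and add up to
      \<open>2 * ?p x s\<close>; otherwise they cancel.\<close>
    have "?p x {1..q} = ?p x ({1..q} - s) * ?p x s"
      using s by (intro prod.subset_diff) auto
    then show "(if ?p x {1..q} = 1 then 2 * ?p x s else 0) = ?p x s + ?p x ({1..q} - s)"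
      using prod_sign_vector[OF x s] prod_sign_vector[OF x, of "{1..q} - s"] by auto
  qed
  also have "\<dots> = (if s = {} then 2 ^ q else 0) + (if {1..q} - s = {} then 2 ^ q else 0)"
    using s by (simp only: sum.distrib sum_sign_vectors_prod Diff_subset)
  also have "{1..q} - s = {} \<longleftrightarrow> s = {1..q}"
    using s by auto
  finally show ?thesis .
qed

theorem proposition7:
  fixes q :: nat
  assumes "q \<ge> 1"
  shows "size (even_half_fraction q) = 2 ^ (q - 1)
    \<and> J_char (even_half_fraction q) {1..q} = 2 ^ (q - 1)
    \<and> (\<forall>s. s \<subseteq> {1..q} \<and> s \<noteq> {} \<and> s \<noteq> {1..q} \<longrightarrow> J_char (even_half_fraction q) s = 0)"
proof (intro conjI allI impI)
  \<comment> \<open>As \<open>q\<close> is positive, the empty and the full set differ, so only one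
    summand survives at each, and its factor 2 cancels.\<close>
  have ne: "{1..q} \<noteq> {}" and pow: "(2 :: int) ^ q = 2 * 2 ^ (q - 1)"
    using assms by (auto simp flip: power_Suc)
  \<comment> \<open>Empty products are 1, so the characteristic at the empty set counts the
    runs.\<close>
  have "int (size (even_half_fraction q)) = J_char (even_half_fraction q) {}"
    unfolding J_char_even_half_fraction by (simp add: even_half_fraction_def)
  also have "\<dots> = int (2 ^ (q - 1))"
    using two_J_char_even_half_fraction[of "{}" q] ne pow by simp
  finally show "size (even_half_fraction q) = 2 ^ (q - 1)"
    by (simp only: of_nat_eq_iff)
  show "J_char (even_half_fraction q) {1..q} = 2 ^ (q - 1)"
    using two_J_char_even_half_fraction[of "{1..q}" q] ne pow by simp
next
  fix s assume "s \<subseteq> {1..q} \<and> s \<noteq> {} \<and> s \<noteq> {1..q}"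
  then show "J_char (even_half_fraction q) s = 0"
    using two_J_char_even_half_fraction[of s q] by simp
qed

end
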